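(* Let $n\in\mathbb{N}$, let $S_1,\ldots,S_n$ be pairwise disjoint finite semigroups, let $S$ be their zero-union, and let $\mathit{NC}=\{i\in\{1,\ldots,n\} : S_i \text{ is not commutative}\}$. Suppose that $|\mathit{NC}|\geqslant 2$. Then $\mathcal{G}(S)$ contains left paths if and only if there exist $i\in\mathit{NC}$ and distinct $x,y\in S_i\setminus Z(S_i)$ such that $x^2=yx$ and $y^2=xy$, in which case $\mathrm{kd}(S)\in\{1,2\}$. Furthermore, $\mathrm{kd}(S)=1$ if and only if there exists $i\in\mathit{NC}$ such that $\mathcal{G}(S_i)$ contains left paths and $\mathrm{kd}(S_i)=1$.
   Context: Zero-union: for pairwise disjoint semigroups $S_1,\ldots,S_n$, their zero-union is the set $\{0\}\cup\bigcup_{i=1}^n S_i$, where $0$ is a new element, and where the product of $x$ and $y$ is the element $xy\in S_i$ if $x,y\in S_i$ for some $i$, and is $0$ in all remaining cases. The center of a semigroup $T$ is $Z(T)=\{x\in T: xy=yx \text{ for all } y\in T\}$. For a finite non-commutative semigroup $T$, the commuting graph $\mathcal{G}(T)$ is the simple graph with vertex set $T\setminus Z(T)$ in which two distinct vertices $x,y$ are adjacent if and only if $xy=yx$. A left path in $\mathcal{G}(T)$ is a path $x_1,\ldots,x_m$ in $\mathcal{G}(T)$ (pairwise distinct vertices, consecutive ones adjacent) such that $x_1\neq x_m$ and $x_1x_i=x_mx_i$ for all $i\in\{1,\ldots,m\}$. Its length is its number of edges, $m-1$. If $\mathcal{G}(T)$ contains left paths, the knit degree $\mathrm{kd}(T)$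 of $T$ is the length of a shortest left path in $\mathcal{G}(T)$ (it is defined only in this case). *)

theory Defs
  imports "HOL-Algebra.Congruence" "Graph_Theory.Graph_Theory"
begin

record 'a magma = "'a partial_object" +
  mult :: "'a \<Rightarrow> 'a \<Rightarrow> 'a" (infixl \<open>\<odot>\<index>\<close> 70)

locale carrier_semigroup =
  fixes T :: "('a, 'm) magma_scheme" (structure)
  assumes m_closed: "\<lbrakk>x \<in> carrier T; y \<in> carrier T\<rbrakk> \<Longrightarrow> x \<odot> y \<in> carrier T"
    and m_assoc: "\<lbrakk>x \<in> carrier T; y \<in> carrier T; z \<in> carrier T\<rbrakk>
      \<Longrightarrow> (x \<odot> y) \<odot> z = x \<odot> (y \<odot> z)"

definition commutative :: "('a, 'm) magma_scheme \<Rightarrow> bool" where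
  "commutative T \<longleftrightarrow> (\<forall>x\<in>carrier T. \<forall>y\<in>carrier T. x \<odot>\<^bsub>T\<^esub> y = y \<odot>\<^bsub>T\<^esub> x)"

definition center :: "('a, 'm) magma_scheme \<Rightarrow> 'a set" where
  "center T = {x \<in> carrier T. \<forall>y\<in>carrier T. x \<odot>\<^bsub>T\<^esub> y = y \<odot>\<^bsub>T\<^esub> x}"

text \<open>
  An undirected edge is represented by the two arcs joining its ends, following the convention
  of the graph library (locale \<^locale>\<open>pair_graph\<close>) for finite simple graphs.
\<close>

definition commuting_graph :: "('a, 'm) magma_scheme \<Rightarrow> 'a pair_pre_digraph" where
  "commuting_graph T =
    \<lparr> pverts = carrier T - center T,
      parcs = {(x, y). x \<in> carrier T - center T \<and> y \<in> carrier T - center T \<and>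
                 x \<noteq> y \<and> x \<odot>\<^bsub>T\<^esub> y = y \<odot>\<^bsub>T\<^esub> x} \<rparr>"

lemma pair_graph_commuting_graph:
  assumes "finite (carrier T)"
  shows "pair_graph (commuting_graph T)"
proof -
  have "parcs (commuting_graph T) \<subseteq> carrier T \<times> carrier T"
    by (auto simp: commuting_graph_def)
  then have "finite (parcs (commuting_graph T))"
    using assms finite_subset by blast
  then show ?thesis
    using assms
    by unfold_locales (auto simp: commuting_graph_def symmetric_def sym_def)
qed

definition left_path :: "('a, 'm) magma_scheme \<Rightarrow> 'a list \<Rightarrow> bool" where
  "left_path T p \<longleftrightarrow> vpath p (commuting_graph T) \<and> hd p \<noteq> last p \<and>
    (\<forall>z\<in>set p. hd p \<odot>\<^bsub>T\<^esub> z = last p \<odot>\<^bsub>T\<^esub> z)"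

definition has_left_paths :: "('a, 'm) magma_scheme \<Rightarrow> bool" where
  "has_left_paths T \<longleftrightarrow> (\<exists>p. left_path T p)"

text \<open>
  The knit degree is only meaningful under \<^const>\<open>has_left_paths\<close>; otherwise the
  \<open>LEAST\<close> below is an unspecified number.
\<close>

definition knit_degree :: "('a, 'm) magma_scheme \<Rightarrow> nat" where
  "knit_degree T = (LEAST k. \<exists>p. left_path T p \<and> vwalk_length p = k)"

text \<open>
  The new zero element is \<^const>\<open>None\<close>. The description operator picks out the index of the
  component containing both factors; it is unique when the components are pairwise disjoint.
\<close>

definition zero_union :: "'i set \<Rightarrow> ('i \<Rightarrow> 'a magma) \<Rightarrow> 'a option magma" where
  "zero_union I S =
    \<lparr> carrier = insert None (Some ` (\<Union>i\<in>I. carrier (S i))),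
      mult = (\<lambda>x y. case (x, y) of
          (Some a, Some b) \<Rightarrow>
            if \<exists>i\<in>I. a \<in> carrier (S i) \<and> b \<in> carrier (S i)
            then Some (a \<odot>\<^bsub>S (THE i. i \<in> I \<and> a \<in> carrier (S i) \<and> b \<in> carrier (S i))\<^esub> b)
            else None
        | _ \<Rightarrow> None) \<rparr>"

context
  fixes I :: "'i set" and S :: "'i \<Rightarrow> 'a magma"
  assumes disjoint: "disjoint_family_on (\<lambda>i. carrier (S i)) I"
begin

lemma zero_union_index_unique:
  "\<lbrakk>i \<in> I; j \<in> I; a \<in> carrier (S i); a \<in> carrier (S j)\<rbrakk> \<Longrightarrow> i = j"
  using disjoint by (auto simp: disjoint_family_on_def)

lemma zero_union_mult_same:
  assumes "i \<in> I" "a \<in> carrier (S i)" "b \<in> carrier (S i)"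
  shows "Some a \<odot>\<^bsub>zero_union I S\<^esub> Some b = Some (a \<odot>\<^bsub>S i\<^esub> b)"
proof -
  have "(THE j. j \<in> I \<and> a \<in> carrier (S j) \<and> b \<in> carrier (S j)) = i"
    using assms by (intro the_equality) (auto intro: zero_union_index_unique)
  then show ?thesis
    using assms by (auto simp: zero_union_def)
qed

lemma zero_union_mult_diff:
  assumes "i \<in> I" "j \<in> I" "i \<noteq> j" "a \<in> carrier (S i)" "b \<in> carrier (S j)"
  shows "Some a \<odot>\<^bsub>zero_union I S\<^esub> Some b = None"
proof -
  have "\<not> (\<exists>k\<in>I. a \<in> carrier (S k) \<and> b \<in> carrier (S k))"
    using assms by (metis zero_union_index_unique)
  then show ?thesis
    by (simp add: zero_union_def)
qed

lemma zero_union_mult_None: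
  "None \<odot>\<^bsub>zero_union I S\<^esub> y = None" "x \<odot>\<^bsub>zero_union I S\<^esub> None = None"
  by (auto simp: zero_union_def split: option.splits)

lemma carrier_semigroup_zero_union:
  assumes sg: "\<And>i. i \<in> I \<Longrightarrow> carrier_semigroup (S i)"
  shows "carrier_semigroup (zero_union I S)"
proof -
  have car: "carrier (zero_union I S) = insert None (Some ` (\<Union>i\<in>I. carrier (S i)))"
    by (simp add: zero_union_def)
  have closed: "\<And>i a b. \<lbrakk>i \<in> I; a \<in> carrier (S i); b \<in> carrier (S i)\<rbrakk>
      \<Longrightarrow> a \<odot>\<^bsub>S i\<^esub> b \<in> carrier (S i)"
    by (rule carrier_semigroup.m_closed[OF sg])
  show ?thesis
  proof
    fix x y assume "x \<in> carrier (zero_union I S)" "y \<in> carrier (zero_union I S)"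
    then consider "x = None \<or> y = None"
      | i j a b where "x = Some a" "y = Some b" "i \<in> I" "j \<in> I"
          "a \<in> carrier (S i)" "b \<in> carrier (S j)"
      unfolding car by blast
    then show "x \<odot>\<^bsub>zero_union I S\<^esub> y \<in> carrier (zero_union I S)"
    proof cases
      case 1
      then show ?thesis by (auto simp: zero_union_mult_None car)
    next
      case (2 i j a b)
      then show ?thesis
        using zero_union_mult_same[of i a b] zero_union_mult_diff[of i j a b] closed[of i a b]
        by (cases "i = j") (auto simp: car)
    qed
  next
    fix x y z
    assume "x \<in> carrier (zero_union I S)" "y \<in> carrier (zero_union I S)"
      "z \<in> carrier (zero_union I S)"
    then consider "x = None \<or> y = None \<or> z = None"
      | i j k a b c where "x = Some a" "y = Some b" "z = Some c" "i \<in> I" "j \<in> I" "k \<in> I"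
          "a \<in> carrier (S i)" "b \<in> carrier (S j)" "c \<in> carrier (S k)"
      unfolding car by blast
    then show "(x \<odot>\<^bsub>zero_union I S\<^esub> y) \<odot>\<^bsub>zero_union I S\<^esub> z
        = x \<odot>\<^bsub>zero_union I S\<^esub> (y \<odot>\<^bsub>zero_union I S\<^esub> z)"
    proof cases
      case 1
      then show ?thesis by (auto simp: zero_union_mult_None)
    next
      case (2 i j k a b c)
      note xyz = 2
      have assoc: "(a \<odot>\<^bsub>S i\<^esub> b) \<odot>\<^bsub>S i\<^esub> c = a \<odot>\<^bsub>S i\<^esub> (b \<odot>\<^bsub>S i\<^esub> c)" if "i = j" "j = k"
        using 2 that carrier_semigroup.m_assoc[OF sg[OF 2(4)]] by simp
      consider "i = j" "j = k" | "i = j" "j \<noteq> k" | "i \<noteq> j" "j = k" | "i \<noteq> j" "j \<noteq> k"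
        by blast
      then show ?thesis
      proof cases
        case 1
        have c: "a \<in> carrier (S i)" "b \<in> carrier (S i)" "c \<in> carrier (S i)"
          using xyz 1 by simp_all
        show ?thesis
          unfolding xyz(1,2,3) using xyz(4) c closed[OF xyz(4)] assoc[OF 1]
          by (simp add: zero_union_mult_same[OF xyz(4)])
      next
        case 2
        have c: "b \<in> carrier (S i)" using xyz 2 by simp
        show ?thesis
          unfolding xyz(1,2,3)
          using xyz 2 zero_union_mult_same[OF xyz(4,7) c] closed[OF xyz(4,7) c]
            zero_union_mult_diff[of i k] zero_union_mult_diff[of j k] by (simp add: zero_union_mult_None)
      next
        case 3
        have c: "c \<in> carrier (S j)" using xyz 3 by simp
        show ?thesis
          unfolding xyz(1,2,3)
          using xyz 3 zero_union_mult_same[OF xyz(5,8) c] closed[OF xyz(5,8) c]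
            zero_union_mult_diff[of i j] by (simp add: zero_union_mult_None)
      next
        case 4
        show ?thesis
          unfolding xyz(1,2,3)
          using xyz 4 zero_union_mult_diff[of i j] zero_union_mult_diff[of j k]
          by (simp add: zero_union_mult_None)
      qed
    qed
  qed
qed

end

end

theory Submission
  imports Defs
begin

text \<open>
  The first and last vertices \<open>x\<close>, \<open>y\<close> of a left path satisfy \<open>xx = yx\<close> and \<open>yy = xy\<close>, because both
  ends lie on the path. Conversely, in a zero-union whose components include a second
  non-commutative one, every such pair \<open>x \<noteq> y\<close> of non-central elements is joined by a left path of
  length two: a non-central \<open>z\<close> of another component annihilates \<open>x\<close> and \<open>y\<close> from both sides, so
  \<open>x, z, y\<close> is a path and \<open>xz = 0 = yz\<close>. Hence the knit degree is at most two, and it is one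
  exactly when some such pair commutes (\<open>has_left_paths_knit_degree_1_iff\<close>).

  It remains to transport such pairs between the zero-union and its components. The zero-union
  has as non-central elements precisely those of the components (\<open>noncentral_zero_union\<close>), and two
  such elements \<open>x\<close>, \<open>y\<close> with \<open>xx = yx\<close> lie in one component, because \<open>xx\<close> is never the new zero
  (\<open>left_twins_zero_union_iff\<close>).
\<close>

section \<open>The ends of a left path\<close>

text \<open>
  The pairs that can be the two ends of a left path, as far as the products among the ends
  themselves decide it.
\<close>

definition left_twins :: "('a, 'm) magma_scheme \<Rightarrow> 'a \<Rightarrow> 'a \<Rightarrow> bool" where
  "left_twins T x y \<longleftrightarrow> x \<in> carrier T - center T \<and> y \<in> carrier T - center T \<and> x \<noteq> y \<and>
    x \<odot>\<^bsub>T\<^esub> x = y \<odot>\<^bsub>T\<^esub> x \<and> y \<odot>\<^bsub>T\<^esub> y = x \<odot>\<^bsub>T\<^esub> y"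

lemma left_twins_not_commutative:
  "left_twins T x y \<Longrightarrow> \<not> commutative T"
  by (auto simp: left_twins_def center_def commutative_def)

lemma left_path_iff:
  "left_path T p \<longleftrightarrow> p \<noteq> [] \<and> distinct p \<and> set p \<subseteq> carrier T - center T \<and>
    set (vwalk_arcs p) \<subseteq> parcs (commuting_graph T) \<and> hd p \<noteq> last p \<and>
    (\<forall>z\<in>set p. hd p \<odot>\<^bsub>T\<^esub> z = last p \<odot>\<^bsub>T\<^esub> z)"
  by (auto simp: left_path_def vpath_def vwalk_def commuting_graph_def)

lemma left_path_left_twins:
  assumes "left_path T p"
  shows "left_twins T (hd p) (last p)"
proof -
  have "hd p \<in> set p" "last p \<in> set p"
    using assms by (auto simp: left_path_iff)
  then show ?thesis
    using assms unfolding left_path_iff left_twins_def by (metis subsetD)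
qed

lemma left_path_length_pos:
  assumes "left_path T p"
  shows "0 < vwalk_length p"
  using assms by (cases p rule: vwalk_arcs.cases) (auto simp: left_path_iff)

lemma left_path_pair_iff:
  "left_path T [x, y] \<longleftrightarrow> left_twins T x y \<and> x \<odot>\<^bsub>T\<^esub> y = y \<odot>\<^bsub>T\<^esub> x"
  by (auto simp: left_path_iff left_twins_def commuting_graph_def)

lemma left_twins_path_via:
  assumes "left_twins T x y" and "z \<in> carrier T - center T" and "z \<noteq> x" "z \<noteq> y"
    and "x \<odot>\<^bsub>T\<^esub> z = y \<odot>\<^bsub>T\<^esub> z" "x \<odot>\<^bsub>T\<^esub> z = z \<odot>\<^bsub>T\<^esub> x" "y \<odot>\<^bsub>T\<^esub> z = z \<odot>\<^bsub>T\<^esub> y"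
  shows "left_path T [x, z, y]"
  using assms by (auto simp: left_path_iff left_twins_def commuting_graph_def)

lemma knit_degree_le:
  assumes "left_path T p"
  shows "knit_degree T \<le> vwalk_length p"
  unfolding knit_degree_def by (rule Least_le) (use assms in blast)

lemma knit_degree_attained:
  assumes "has_left_paths T"
  obtains p where "left_path T p" "vwalk_length p = knit_degree T"
proof -
  have "\<exists>k p. left_path T p \<and> vwalk_length p = k"
    using assms by (auto simp: has_left_paths_def)
  from LeastI_ex[OF this] show thesis
    using that unfolding knit_degree_def by blast
qed

lemma knit_degree_pos:
  assumes "has_left_paths T"
  shows "0 < knit_degree T"
  using knit_degree_attained[OF assms] left_path_length_pos by metis

text \<open>
  A shortest left path of length one is just its two ends, and no left path is shorter, since the
  ends are distinct.
\<close>

lemma has_left_paths_knit_degree_1_iff: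
  "has_left_paths T \<and> knit_degree T = 1 \<longleftrightarrow>
    (\<exists>x y. left_twins T x y \<and> x \<odot>\<^bsub>T\<^esub> y = y \<odot>\<^bsub>T\<^esub> x)"
proof
  assume "has_left_paths T \<and> knit_degree T = 1"
  then obtain p where p: "left_path T p" "vwalk_length p = 1"
    using knit_degree_attained by metis
  then have "length p = 2"
    by simp
  then obtain x y where "p = [x, y]"
    by (auto simp: numeral_2_eq_2 length_Suc_conv)
  then show "\<exists>x y. left_twins T x y \<and> x \<odot>\<^bsub>T\<^esub> y = y \<odot>\<^bsub>T\<^esub> x"
    using p left_path_pair_iff by metis
next
  assume "\<exists>x y. left_twins T x y \<and> x \<odot>\<^bsub>T\<^esub> y = y \<odot>\<^bsub>T\<^esub> x"
  then obtain x y where p: "left_path T [x, y]"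
    using left_path_pair_iff by metis
  then have "has_left_paths T"
    by (auto simp: has_left_paths_def)
  with knit_degree_le[OF p] knit_degree_pos[of T] show "has_left_paths T \<and> knit_degree T = 1"
    by simp
qed

section \<open>Zero-unions\<close>

lemma zero_union_mult_Some_iff:
  assumes "disjoint_family_on (\<lambda>i. carrier (S i)) I" "i \<in> I" "j \<in> I"
    and "a \<in> carrier (S i)" "b \<in> carrier (S j)"
  shows "Some a \<odot>\<^bsub>zero_union I S\<^esub> Some b \<noteq> None \<longleftrightarrow> i = j"
  using assms zero_union_mult_same[OF assms(1), of i a b] zero_union_mult_diff[OF assms(1), of i j a b]
  by (cases "i = j") auto

text \<open>
  The new zero is central, and elements of distinct components commute, having product zero in both
  orders. So whether an element is central is decided inside its own component.
\<close>

lemma noncentral_zero_union: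
  assumes disj: "disjoint_family_on (\<lambda>i. carrier (S i)) I"
  shows "carrier (zero_union I S) - center (zero_union I S)
    = Some ` (\<Union>i\<in>I. carrier (S i) - center (S i))"
proof -
  let ?Z = "zero_union I S"
  have carr: "carrier ?Z = insert None (Some ` (\<Union>i\<in>I. carrier (S i)))"
    by (simp add: zero_union_def)
  have None: "None \<in> center ?Z"
    by (auto simp: center_def carr zero_union_mult_None[OF disj])
  have Some: "Some a \<in> center ?Z \<longleftrightarrow> a \<in> center (S i)" if i: "i \<in> I" "a \<in> carrier (S i)" for i a
  proof
    assume "Some a \<in> center ?Z"
    then have "Some a \<odot>\<^bsub>?Z\<^esub> Some b = Some b \<odot>\<^bsub>?Z\<^esub> Some a" if "b \<in> carrier (S i)" for b
      using that i by (auto simp: center_def carr)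
    then show "a \<in> center (S i)"
      using i by (simp add: center_def zero_union_mult_same[OF disj i(1)])
  next
    assume a: "a \<in> center (S i)"
    have "Some a \<odot>\<^bsub>?Z\<^esub> Some b = Some b \<odot>\<^bsub>?Z\<^esub> Some a" if j: "j \<in> I" "b \<in> carrier (S j)" for j b
    proof (cases "i = j")
      case True
      then show ?thesis
        using a i j by (simp add: center_def zero_union_mult_same[OF disj])
    next
      case False
      then show ?thesis
        using i j by (simp add: zero_union_mult_diff[OF disj, of i j]
            zero_union_mult_diff[OF disj, of j i])
    qed
    then show "Some a \<in> center ?Z"
      using i by (auto simp: center_def carr zero_union_mult_None[OF disj])
  qed
  show ?thesis
    using None Some by (auto simp: carr)
qed

text \<open>
  Squares in a zero-union of elements other than the new zero are not zero, so \<open>uu = vu\<close> places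
  \<open>u\<close> and \<open>v\<close> in one component.
\<close>

lemma left_twins_zero_union_iff:
  assumes disj: "disjoint_family_on (\<lambda>i. carrier (S i)) I"
  shows "left_twins (zero_union I S) u v \<longleftrightarrow>
    (\<exists>i\<in>I. \<exists>x y. u = Some x \<and> v = Some y \<and> left_twins (S i) x y)"
proof
  assume uv: "left_twins (zero_union I S) u v"
  then obtain i j x y where
    x: "u = Some x" "i \<in> I" "x \<in> carrier (S i) - center (S i)" and
    y: "v = Some y" "j \<in> I" "y \<in> carrier (S j) - center (S j)"
    unfolding left_twins_def noncentral_zero_union[OF disj] by blast
  have "Some x \<odot>\<^bsub>zero_union I S\<^esub> Some x = Some y \<odot>\<^bsub>zero_union I S\<^esub> Some x"
    using uv x y by (simp add: left_twins_def)
  then have "j = i"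
    using x y zero_union_mult_Some_iff[OF disj, of i i x x]
      zero_union_mult_Some_iff[OF disj, of j i y x] by auto
  then have "left_twins (S i) x y"
    using uv x y by (auto simp: left_twins_def zero_union_mult_same[OF disj x(2)])
  then show "\<exists>i\<in>I. \<exists>x y. u = Some x \<and> v = Some y \<and> left_twins (S i) x y"
    using x y by blast
next
  assume "\<exists>i\<in>I. \<exists>x y. u = Some x \<and> v = Some y \<and> left_twins (S i) x y"
  then obtain i x y where i: "i \<in> I" and xy: "u = Some x" "v = Some y" "left_twins (S i) x y"
    by blast
  then have "u \<in> carrier (zero_union I S) - center (zero_union I S)"
    "v \<in> carrier (zero_union I S) - center (zero_union I S)"
    unfolding noncentral_zero_union[OF disj] left_twins_def by blast+
  then show "left_twins (zero_union I S) u v"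
    using i xy by (auto simp: left_twins_def zero_union_mult_same[OF disj i])
qed

text \<open>
  The middle vertex is a non-central element of another component; it has product zero with both
  ends.
\<close>

lemma left_twins_zero_union_path:
  assumes disj: "disjoint_family_on (\<lambda>i. carrier (S i)) I"
    and i: "i \<in> I" and xy: "left_twins (S i) x y"
    and j: "j \<in> I" "j \<noteq> i" and noncomm: "\<not> commutative (S j)"
  obtains z where "left_path (zero_union I S) [Some x, Some z, Some y]"
proof -
  obtain z where z: "z \<in> carrier (S j) - center (S j)"
    using noncomm by (auto simp: commutative_def center_def)
  have x: "x \<in> carrier (S i)" and y: "y \<in> carrier (S i)"
    using xy by (auto simp: left_twins_def)
  have "left_path (zero_union I S) [Some x, Some z, Some y]"
  proof (rule left_twins_path_via)
    show "left_twins (zero_union I S) (Some x) (Some y)"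
      using i xy left_twins_zero_union_iff[OF disj] by blast
    show "Some z \<in> carrier (zero_union I S) - center (zero_union I S)"
      unfolding noncentral_zero_union[OF disj] using j z by blast
    show "Some z \<noteq> Some x" "Some z \<noteq> Some y"
      using zero_union_index_unique[OF disj i j(1)] j(2) x y z by auto
  qed (use i j x y z zero_union_mult_diff[OF disj, of i j] zero_union_mult_diff[OF disj, of j i]
      in auto)
  then show thesis
    by (rule that)
qed

theorem theorem3p8:
  fixes n :: nat and S :: "nat \<Rightarrow> 'a magma" and Z :: "'a option magma" and NC :: "nat set"
  assumes "\<And>i. i \<in> {1..n} \<Longrightarrow> carrier_semigroup (S i)"
    and "\<And>i. i \<in> {1..n} \<Longrightarrow> finite (carrier (S i))"
    and "disjoint_family_on (\<lambda>i. carrier (S i)) {1..n}"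
    and "Z = zero_union {1..n} S"
    and "NC = {i \<in> {1..n}. \<not> commutative (S i)}"
    and "card NC \<ge> 2"
  shows "(has_left_paths Z \<longleftrightarrow>
      (\<exists>i\<in>NC. \<exists>x\<in>carrier (S i) - center (S i). \<exists>y\<in>carrier (S i) - center (S i).
         x \<noteq> y \<and> x \<odot>\<^bsub>S i\<^esub> x = y \<odot>\<^bsub>S i\<^esub> x \<and> y \<odot>\<^bsub>S i\<^esub> y = x \<odot>\<^bsub>S i\<^esub> y))
    \<and> (has_left_paths Z \<longrightarrow> knit_degree Z \<in> {1, 2})
    \<and> (has_left_paths Z \<and> knit_degree Z = 1 \<longleftrightarrow>
      (\<exists>i\<in>NC. has_left_paths (S i) \<and> knit_degree (S i) = 1))"
proof -
  note disj = assms(3)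
  have NC_iff: "i \<in> NC \<longleftrightarrow> i \<in> {1..n}" if "left_twins (S i) x y" for i x y
    using left_twins_not_commutative[OF that] by (simp add: assms(5))
  have twins: "left_twins Z u v \<longleftrightarrow>
      (\<exists>i\<in>NC. \<exists>x y. u = Some x \<and> v = Some y \<and> left_twins (S i) x y)" for u v
    using left_twins_zero_union_iff[OF disj, of u v] NC_iff unfolding assms(4) by metis
  have short: "\<exists>p. left_path Z p \<and> vwalk_length p = 2" if i: "i \<in> NC" "left_twins (S i) x y" for i x y
  proof -
    have "finite NC"
      using assms(5) by simp
    moreover have "\<not> card NC \<le> Suc 0"
      using assms(6) by simp
    ultimately obtain j where j: "j \<in> NC" "j \<noteq> i"
      using i(1) card_le_Suc0_iff_eq by metis
    have "i \<in> {1..n}" "j \<in> {1..n}" "\<not> commutative (S j)"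
      using i j assms(5) by simp_all
    from left_twins_zero_union_path[OF disj this(1) i(2) this(2) j(2) this(3)]
    obtain z where "left_path Z [Some x, Some z, Some y]"
      using assms(4) by metis
    moreover have "vwalk_length [Some x, Some z, Some y] = 2"
      by simp
    ultimately show ?thesis
      by metis
  qed
  have has: "has_left_paths Z \<longleftrightarrow> (\<exists>i\<in>NC. \<exists>x y. left_twins (S i) x y)"
  proof
    assume "has_left_paths Z"
    then obtain p where "left_path Z p"
      by (auto simp: has_left_paths_def)
    then show "\<exists>i\<in>NC. \<exists>x y. left_twins (S i) x y"
      using left_path_left_twins twins by metis
  next
    assume "\<exists>i\<in>NC. \<exists>x y. left_twins (S i) x y"
    then show "has_left_paths Z"
      using short unfolding has_left_paths_def by metis
  qed
  have deg: "knit_degree Z \<in> {1, 2}" if lp: "has_left_paths Z"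
  proof -
    obtain p where p: "left_path Z p" "vwalk_length p = 2"
      using lp has short by metis
    have "knit_degree Z \<le> 2" "0 < knit_degree Z"
      using knit_degree_le[OF p(1)] p(2) knit_degree_pos[OF lp] by simp_all
    then show ?thesis
      by auto
  qed
  have comm: "Some x \<odot>\<^bsub>Z\<^esub> Some y = Some y \<odot>\<^bsub>Z\<^esub> Some x \<longleftrightarrow> x \<odot>\<^bsub>S i\<^esub> y = y \<odot>\<^bsub>S i\<^esub> x"
    if xy: "left_twins (S i) x y" and "i \<in> NC" for i x y
  proof -
    have "i \<in> {1..n}"
      using that NC_iff by simp
    moreover have "x \<in> carrier (S i)" "y \<in> carrier (S i)"
      using xy by (simp_all add: left_twins_def)
    ultimately show ?thesis
      unfolding assms(4) using zero_union_mult_same[OF disj] by (metis option.inject)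
  qed
  have "has_left_paths Z \<and> knit_degree Z = 1 \<longleftrightarrow>
      (\<exists>i\<in>NC. \<exists>x y. left_twins (S i) x y \<and> x \<odot>\<^bsub>S i\<^esub> y = y \<odot>\<^bsub>S i\<^esub> x)"
    unfolding has_left_paths_knit_degree_1_iff using twins comm by metis
  also have "\<dots> \<longleftrightarrow> (\<exists>i\<in>NC. has_left_paths (S i) \<and> knit_degree (S i) = 1)"
    unfolding has_left_paths_knit_degree_1_iff ..
  finally have deg1: "has_left_paths Z \<and> knit_degree Z = 1 \<longleftrightarrow>
      (\<exists>i\<in>NC. has_left_paths (S i) \<and> knit_degree (S i) = 1)" .
  have "(\<exists>x y. left_twins (S i) x y) \<longleftrightarrow>
      (\<exists>x\<in>carrier (S i) - center (S i). \<exists>y\<in>carrier (S i) - center (S i).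
         x \<noteq> y \<and> x \<odot>\<^bsub>S i\<^esub> x = y \<odot>\<^bsub>S i\<^esub> x \<and> y \<odot>\<^bsub>S i\<^esub> y = x \<odot>\<^bsub>S i\<^esub> y)" for i
    unfolding left_twins_def by blast
  with has deg deg1 show ?thesis
    by simp
qed

end
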